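(* Let $\psi(x)=\sum_{n\ge 0}\gamma_n x^n/n!$ be a Laguerre–Pólya function, not identically zero. Then $(\gamma_n)_{n\ge 0}$ is completely monotone if and only if $$\psi(x)=\gamma_0\,e^{qx}\qquad\text{for some }q\in[0,1]\ \text{and}\ \gamma_0>0.$$
   Context: The Laguerre–Pólya class consists of the real entire functions that are locally uniform limits of real polynomials with only real zeros; equivalently, of the functions $Cx^me^{\sigma x-\beta x^2}\prod_k(1+x/x_k)e^{-x/x_k}$ with $C,\sigma\in\mathbb R$, $\beta\ge 0$, $m\in\{0,1,2,\dots\}$, $x_k\in\mathbb R\setminus\{0\}$, $\sum_k x_k^{-2}<\infty$ (the product finite, possibly empty, or infinite). A sequence $(c_n)_{n\ge 0}$ of reals is completely monotone if $\Delta^k c_n\ge 0$ for all $n,k\ge 0$, where $\Delta c_n=c_n-c_{n+1}$. *)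

theory Defs
  imports "HOL-Complex_Analysis.Complex_Analysis"
begin

definition real_entire :: "(complex \<Rightarrow> complex) \<Rightarrow> bool" where
  "real_entire f \<longleftrightarrow> f holomorphic_on UNIV \<and> (\<forall>x\<in>\<real>. f x \<in> \<real>)"

text \<open>
  All complex zeros are real; nonzero constants qualify, the zero polynomial does not.
\<close>
definition only_real_zeros :: "real poly \<Rightarrow> bool" where
  "only_real_zeros p \<longleftrightarrow> (\<forall>z. poly (map_poly complex_of_real p) z = 0 \<longrightarrow> z \<in> \<real>)"

definition laguerre_polya :: "(complex \<Rightarrow> complex) \<Rightarrow> bool" where
  "laguerre_polya f \<longleftrightarrow> real_entire f \<and>
     (\<exists>p :: nat \<Rightarrow> real poly. (\<forall>n. only_real_zeros (p n)) \<and>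
        (\<forall>z. \<exists>d>0. uniform_limit (cball z d)
           (\<lambda>n w. poly (map_poly complex_of_real (p n)) w) f sequentially))"

text \<open>
  The sign convention is opposite to that of the usual forward difference.
\<close>
definition diff_op :: "(nat \<Rightarrow> real) \<Rightarrow> nat \<Rightarrow> real" where
  "diff_op c n = c n - c (Suc n)"

definition completely_monotone :: "(nat \<Rightarrow> real) \<Rightarrow> bool" where
  "completely_monotone c \<longleftrightarrow> (\<forall>n k. (diff_op ^^ k) c n \<ge> 0)"

end

theory Submission imports Defs "HOL-Computational_Algebra.Fundamental_Theorem_Algebra" begin

text \<open>
  Two inequalities in opposite directions meet.

  A real polynomial with only real zeros has coefficients with \<open>2 a\<^sub>0 a\<^sub>2 \<le> a\<^sub>1\<^sup>2\<close>. Coefficients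
  are continuous under locally uniform convergence, so a Laguerre--Polya function inherits the
  inequality; its coefficients are \<open>\<gamma>\<^sub>n / n!\<close>, and it becomes the Turan inequality \<open>\<gamma>\<^sub>0 \<gamma>\<^sub>2 \<le> \<gamma>\<^sub>1\<^sup>2\<close> (\<open>laguerre_polya_turan\<close>).

  A completely monotone sequence is the moment sequence of a positive measure on \<open>[0,1]\<close>
  (Hausdorff), so the Cauchy--Schwarz inequality gives \<open>\<gamma>\<^sub>1\<^sup>2 \<le> \<gamma>\<^sub>0 \<gamma>\<^sub>2\<close>. Equality in it
  forces the measure to be a point mass at \<open>q = \<gamma>\<^sub>1 / \<gamma>\<^sub>0\<close>, hence \<open>\<gamma>\<^sub>n = \<gamma>\<^sub>0 q\<^sup>n\<close>, which says
  that \<open>\<psi>\<close> is an exponential. Conversely, the \<open>k\<close>-th difference of \<open>\<gamma>\<^sub>0 q\<^sup>n\<close> is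
  \<open>\<gamma>\<^sub>0 q\<^sup>n (1 - q)\<^sup>k\<close>.

  The measure itself is never constructed. Write \<open>L\<close> for the linear functional that sends \<open>t\<^sup>n\<close>
  to \<open>\<gamma>\<^sub>n\<close>. What is needed is that \<open>L ((t - a)\<^sup>2) \<ge> 0\<close>
  (\<open>completely_monotone_quadratic_nonneg\<close>), which follows by applying \<open>L\<close> to Bernstein
  polynomials, and that \<open>L ((t - q)\<^sup>2) = 0\<close> implies \<open>L (t\<^sup>n (t - q)\<^sup>2) = 0\<close>
  (\<open>completely_monotone_quadratic_eq_0\<close>), which follows from the splitting \<open>1 = t + (1 - t)\<close>.
  The latter is a linear recurrence for \<open>\<gamma>\<close> whose characteristic polynomial is \<open>(t - q)\<^sup>2\<close>.
\<close>

section \<open>Positivity for completely monotone sequences\<close>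

lemma diff_op_funpow_Suc: "(diff_op ^^ Suc k) c n = (diff_op ^^ k) c n - (diff_op ^^ k) c (Suc n)"
  by (simp add: diff_op_def)

lemma diff_op_funpow_shift: "(diff_op ^^ k) (\<lambda>n. c (n + m)) n = (diff_op ^^ k) c (n + m)"
  by (induction k arbitrary: n) (simp_all add: diff_op_def)

lemma diff_op_funpow_geometric:
  "(diff_op ^^ k) (\<lambda>n. a * q ^ n) n = a * q ^ n * (1 - q) ^ k"
  by (induction k arbitrary: n) (simp_all add: diff_op_def algebra_simps)

text \<open>
  This is the binomial expansion of \<open>(E + \<Delta>)\<^sup>N\<close> at index \<open>0\<close>, where \<open>E\<close> is the shift and
  \<open>\<Delta> = 1 - E\<close>; for the moments of a measure it says that the Bernstein polynomials of degree
  \<open>N\<close> sum to \<open>1\<close>.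
\<close>
lemma bernstein_sum:
  "(\<Sum>j\<le>N. real (N choose j) * (diff_op ^^ (N - j)) c j) = c 0"
proof (induction N)
  case 0
  show ?case by simp
next
  case (Suc N)
  define D where "D k j = (diff_op ^^ k) c j" for k j
  have D_Suc: "D (Suc k) j = D k j - D k (Suc j)" for k j
    unfolding D_def by (rule diff_op_funpow_Suc)
  have "(\<Sum>j\<le>Suc N. real (Suc N choose j) * D (Suc N - j) j)
      = D (Suc N) 0 + (\<Sum>j\<le>N. real (Suc N choose Suc j) * D (N - j) (Suc j))"
    by (subst sum.atMost_Suc_shift) simp
  also have "\<dots> = (D (Suc N) 0 + (\<Sum>j\<le>N. real (N choose Suc j) * D (N - j) (Suc j)))
      + (\<Sum>j\<le>N. real (N choose j) * D (N - j) (Suc j))"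
    by (simp add: distrib_right sum.distrib)
  also have "D (Suc N) 0 + (\<Sum>j\<le>N. real (N choose Suc j) * D (N - j) (Suc j))
      = (\<Sum>j\<le>Suc N. real (N choose j) * D (Suc N - j) j)"
    by (subst sum.atMost_Suc_shift) simp
  also have "\<dots> = (\<Sum>j\<le>N. real (N choose j) * D (Suc N - j) j)"
    by simp
  also have "\<dots> + (\<Sum>j\<le>N. real (N choose j) * D (N - j) (Suc j))
      = (\<Sum>j\<le>N. real (N choose j) * D (N - j) j)"
    unfolding sum.distrib[symmetric]
    by (intro sum.cong) (simp_all add: Suc_diff_le D_Suc algebra_simps)
  finally show ?case
    using Suc by (simp add: D_def)
qed

text \<open>
  If \<open>j\<close> is binomially distributed with parameters \<open>N\<close> and \<open>t\<close>, then \<open>j choose m\<close> has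
  expectation \<open>(N choose m) t\<^sup>m\<close>. The identity is this fact integrated against the measure
  with moments \<open>c\<close>. It reduces to the case \<open>m = 0\<close> for the shifted sequence by moving the
  binomial factor out of the sum.
\<close>
lemma bernstein_factorial_moment:
  assumes "m \<le> N"
  shows "(\<Sum>j\<le>N. real (j choose m) * (real (N choose j) * (diff_op ^^ (N - j)) c j))
    = real (N choose m) * c m"
proof -
  \<comment> \<open>The terms with \<open>j < m\<close> vanish, so the sum starts at \<open>m\<close>.\<close>
  define g where "g j = real (j choose m) * (real (N choose j) * (diff_op ^^ (N - j)) c j)" for j
  have "(\<Sum>j\<le>N. g j) = (\<Sum>j\<in>{0+m..(N-m)+m}. g j)"
    using assms by (intro sum.mono_neutral_right) (auto simp: g_def)
  also have "\<dots> = (\<Sum>i\<le>N-m. g (i + m))"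
    by (subst sum.shift_bounds_cl_nat_ivl) (simp add: atLeast0AtMost)
  also have "\<dots> = (\<Sum>i\<le>N-m. real (N choose m) *
      (real ((N - m) choose i) * (diff_op ^^ (N - m - i)) (\<lambda>n. c (n + m)) i))"
  proof (intro sum.cong refl)
    fix i assume "i \<in> {..N-m}"
    then have "(N choose (i + m)) * ((i + m) choose m) = (N choose m) * ((N - m) choose i)"
      using assms choose_mult[of m "i + m" N] by simp
    then have "real (N choose (i + m)) * real ((i + m) choose m)
        = real (N choose m) * real ((N - m) choose i)"
      by (metis of_nat_mult)
    then show "g (i + m) = real (N choose m) *
      (real ((N - m) choose i) * (diff_op ^^ (N - m - i)) (\<lambda>n. c (n + m)) i)"
      by (simp add: g_def diff_op_funpow_shift add.commute mult_ac)
  qed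
  also have "\<dots> = real (N choose m) * c m"
    by (simp only: sum_distrib_left[symmetric] bernstein_sum) simp
  finally show ?thesis by (simp add: g_def)
qed

text \<open>
  The Bernstein weights of a completely monotone sequence are nonnegative, and placing them at the
  points \<open>j / N\<close> gives a discrete measure whose second moment differs from \<open>c 2\<close> by
  \<open>(c 1 - c 2) / N\<close>, while \<open>c 0\<close> and \<open>c 1\<close> are matched exactly. The integral of
  \<open>(t - a)\<^sup>2\<close> against it is nonnegative, and \<open>N\<close> may be taken arbitrarily large.
\<close>
lemma completely_monotone_quadratic_nonneg:
  assumes "completely_monotone c"
  shows "0 \<le> c 2 - 2 * a * c 1 + a\<^sup>2 * c 0"
proof (rule ccontr)
  define L where "L = c 2 - 2 * a * c 1 + a\<^sup>2 * c 0"
  assume "\<not> 0 \<le> c 2 - 2 * a * c 1 + a\<^sup>2 * c 0"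
  then have "0 < - L" by (simp add: L_def)
  \<comment> \<open>This is \<open>N L + (c 1 - c 2) \<ge> 0\<close>, which fails for large \<open>N\<close> if \<open>L < 0\<close>.\<close>
  have bound: "real N * - L \<le> c 1 - c 2" if "2 \<le> N" for N
  proof -
    define w where "w j = real (N choose j) * (diff_op ^^ (N - j)) c j" for j
    have w_nonneg: "0 \<le> w j" for j
      using assms by (simp add: w_def completely_monotone_def)
    have moment: "(\<Sum>j\<le>N. real (j choose m) * w j) = real (N choose m) * c m" if "m \<le> N" for m
      using bernstein_factorial_moment[OF that] by (simp add: w_def)
    have choose2: "real (k choose 2) = real k * (real k - 1) / 2" for k
      by (cases k) (simp_all add: choose_two real_of_nat_div field_simps)
    \<comment> \<open>Expand with \<open>j\<^sup>2 = 2 (j choose 2) + j\<close> to reach the factorial moments.\<close>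
    have "(real j - a * real N)\<^sup>2 * w j
        = 2 * (real (j choose 2) * w j) + (1 - 2 * a * real N) * (real (j choose 1) * w j)
          + (a * real N)\<^sup>2 * (real (j choose 0) * w j)" for j
      unfolding choose2 by (simp add: power2_eq_square field_simps)
    then have "(\<Sum>j\<le>N. (real j - a * real N)\<^sup>2 * w j)
        = 2 * (\<Sum>j\<le>N. real (j choose 2) * w j)
          + (1 - 2 * a * real N) * (\<Sum>j\<le>N. real (j choose 1) * w j)
          + (a * real N)\<^sup>2 * (\<Sum>j\<le>N. real (j choose 0) * w j)"
      by (simp only: sum.distrib sum_distrib_left)
    also have "\<dots> = 2 * (real (N choose 2) * c 2) + (1 - 2 * a * real N) * (real (N choose 1) * c 1)
          + (a * real N)\<^sup>2 * (real (N choose 0) * c 0)"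
      using that by (simp only: moment)
    also have "\<dots> = real N * (real N * L + (c 1 - c 2))"
      unfolding choose2 L_def by (simp add: power2_eq_square field_simps)
    finally have "0 \<le> real N * (real N * L + (c 1 - c 2))"
      using w_nonneg by (metis (no_types, lifting) sum_nonneg mult_nonneg_nonneg zero_le_power2)
    then show ?thesis
      using that by (simp add: zero_le_mult_iff)
  qed
  obtain M where "c 1 - c 2 < real M * - L"
    using reals_Archimedean3[OF \<open>0 < - L\<close>] by blast
  also have "\<dots> \<le> real (M + 2) * - L"
    using \<open>0 < - L\<close> by (intro mult_right_mono) auto
  also have "\<dots> \<le> c 1 - c 2"
    by (rule bound) simp
  finally show False by simp
qed

lemma completely_monotone_Suc:
  assumes "completely_monotone c"
  shows "completely_monotone (\<lambda>n. c (Suc n))"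
  using assms diff_op_funpow_shift[of _ c 1] by (simp add: completely_monotone_def)

lemma completely_monotone_diff_op:
  assumes "completely_monotone c"
  shows "completely_monotone (diff_op c)"
  using assms unfolding completely_monotone_def by (metis funpow_Suc_right comp_apply)

lemma completely_monotone_nonneg: "completely_monotone c \<Longrightarrow> 0 \<le> c n"
  unfolding completely_monotone_def by (metis funpow_0)

lemma completely_monotone_decreasing: "completely_monotone c \<Longrightarrow> c (Suc n) \<le> c n"
  using completely_monotone_nonneg[OF completely_monotone_diff_op] by (simp add: diff_op_def)

text \<open>
  Both \<open>E c\<close> and \<open>\<Delta> c\<close> are completely monotone and add up to \<open>c\<close>, so the nonnegative
  quadratic expressions of the two add up to that of \<open>c\<close>. If the latter vanishes, so does that
  of the shift \<open>E c\<close>, and the argument repeats.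
\<close>
lemma completely_monotone_quadratic_eq_0:
  assumes "completely_monotone c" and "c 2 - 2 * q * c 1 + q\<^sup>2 * c 0 = 0"
  shows "c (n + 2) - 2 * q * c (n + 1) + q\<^sup>2 * c n = 0"
  using assms
proof (induction n arbitrary: c)
  case 0
  then show ?case by (simp add: numeral_2_eq_2)
next
  case (Suc n)
  have "0 \<le> c 3 - 2 * q * c 2 + q\<^sup>2 * c 1"
    using completely_monotone_quadratic_nonneg[OF completely_monotone_Suc[OF Suc.prems(1)], of q]
    by (simp add: numeral_eq_Suc)
  moreover have "0 \<le> (c 2 - c 3) - 2 * q * (c 1 - c 2) + q\<^sup>2 * (c 0 - c 1)"
    using completely_monotone_quadratic_nonneg[OF completely_monotone_diff_op[OF Suc.prems(1)], of q]
    by (simp add: diff_op_def numeral_eq_Suc)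
  ultimately have "c 3 - 2 * q * c 2 + q\<^sup>2 * c 1 = 0"
    using Suc.prems(2) by (simp add: algebra_simps)
  then show ?case
    using Suc.IH[OF completely_monotone_Suc[OF Suc.prems(1)]] by (simp add: numeral_eq_Suc)
qed

text \<open>
  Under the reverse Cauchy--Schwarz inequality, the quadratic expression at \<open>a = c 1 / c 0\<close>, where
  it is minimal, is both nonnegative and nonpositive.
\<close>
lemma completely_monotone_geometric:
  assumes cm: "completely_monotone c" and pos: "0 < c 0" and turan: "c 0 * c 2 \<le> (c 1)\<^sup>2"
  shows "c n = c 0 * (c 1 / c 0) ^ n"
proof -
  define q where "q = c 1 / c 0"
  have c1: "c 1 = c 0 * q"
    using pos by (simp add: q_def)
  have "c 2 - 2 * q * c 1 + q\<^sup>2 * c 0 = (c 0 * c 2 - (c 1)\<^sup>2) / c 0"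
    using pos by (simp add: q_def power2_eq_square field_simps)
  also have "\<dots> \<le> 0"
    using pos turan by (simp add: divide_le_0_iff)
  finally have "c 2 - 2 * q * c 1 + q\<^sup>2 * c 0 = 0"
    using completely_monotone_quadratic_nonneg[OF cm, of q] by linarith
  note rec = completely_monotone_quadratic_eq_0[OF cm this]
  have "c n = c 0 * q ^ n \<and> c (Suc n) = c 0 * q ^ Suc n"
  proof (induction n)
    case 0
    then show ?case using c1 by simp
  next
    case (Suc n)
    then have "c (n + 2) = 2 * q * (c 0 * q ^ Suc n) - q\<^sup>2 * (c 0 * q ^ n)"
      using rec[of n] by simp
    also have "\<dots> = c 0 * q ^ Suc (Suc n)"
      by (simp add: power2_eq_square)
    finally show ?case using Suc by simp
  qed
  then show ?thesis by (simp add: q_def)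
qed

section \<open>The Turan inequality for Laguerre--Polya functions\<close>

lemma poly_map_poly_of_real:
  "poly (map_poly of_real p) (of_real x) = (of_real (poly p x) :: 'a :: {comm_ring_1, real_algebra_1})"
  by (induction p) (simp_all add: map_poly_pCons)

text \<open>
  If every zero of \<open>p\<close> is real, then \<open>p\<close> is a constant times a product of real
  linear factors. When \<open>p\<close> does not vanish at \<open>0\<close>, the difference of the two sides is \<open>(p 0)\<^sup>2\<close> times the sum of
  the squares of the reciprocal zeros. Splitting off one zero \<open>r\<close> at a time, \<open>p = (x - r) s\<close>,
  avoids the division and shows that the difference for \<open>p\<close> is \<open>(s 0)\<^sup>2\<close> plus \<open>r\<^sup>2\<close> times
  the difference for \<open>s\<close>.
\<close>
lemma only_real_zeros_coeff:
  assumes "only_real_zeros p"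
  shows "2 * coeff p 0 * coeff p 2 \<le> (coeff p 1)\<^sup>2"
  using assms
proof (induction "degree p" arbitrary: p)
  case 0
  then have "coeff p 2 = 0" by (simp add: coeff_eq_0)
  then show ?case by simp
next
  case (Suc d)
  let ?C = "map_poly complex_of_real"
  have "degree (?C p) = Suc d"
    using Suc.hyps(2) by (simp add: degree_map_poly)
  then have "\<not> constant (poly (?C p))"
    by (simp add: constant_degree)
  then obtain z where z: "poly (?C p) z = 0"
    using fundamental_theorem_of_algebra by blast
  then obtain r where "z = of_real r"
    using Suc.prems by (auto simp: only_real_zeros_def elim: Reals_cases)
  with z have "poly p r = 0"
    by (simp add: poly_map_poly_of_real)
  then obtain s where p: "p = [:- r, 1:] * s"
    by (auto simp: poly_eq_0_iff_dvd elim: dvdE)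
  have "s \<noteq> 0" using p Suc.hyps(2) by auto
  then have "degree p = Suc (degree s)"
    unfolding p by (subst degree_mult_eq) auto
  then have "degree s = d"
    using Suc.hyps(2) by simp
  moreover have "?C p = [:- of_real r, 1:] * ?C s"
    unfolding p by (simp add: poly_eq_iff coeff_map_poly coeff_pCons split: nat.splits)
  then have "only_real_zeros s"
    using Suc.prems by (auto simp: only_real_zeros_def)
  ultimately have IH: "2 * coeff s 0 * coeff s 2 \<le> (coeff s 1)\<^sup>2"
    using Suc.hyps(1) by blast
  have "coeff p 0 = - r * coeff s 0" "coeff p 1 = coeff s 0 - r * coeff s 1"
    "coeff p 2 = coeff s 1 - r * coeff s 2"
    unfolding p by (simp_all add: numeral_eq_Suc)
  then have "(coeff p 1)\<^sup>2 - 2 * coeff p 0 * coeff p 2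
      = (coeff s 0)\<^sup>2 + r\<^sup>2 * ((coeff s 1)\<^sup>2 - 2 * coeff s 0 * coeff s 2)"
    by (simp only:) (simp add: power2_eq_square algebra_simps)
  also have "\<dots> \<ge> 0" using IH by simp
  finally show ?case by simp
qed

lemma powser_coeff_eq_higher_deriv:
  fixes a :: "nat \<Rightarrow> complex"
  assumes "\<And>z. (\<lambda>n. a n * z ^ n) sums f z"
  shows "a n = (deriv ^^ n) f 0 / fact n"
proof -
  have "f has_fps_expansion Abs_fps a"
    using assms by (intro has_fps_expansionI) simp
  from fps_nth_fps_expansion[OF this, of n] show ?thesis by simp
qed

text \<open>
  Locally uniform convergence carries over to the derivatives at \<open>0\<close>, hence to the Taylor
  coefficients \<open>\<gamma> k / fact k\<close>; the factor \<open>2\<close> of the polynomial inequality is absorbed by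
  \<open>fact 2\<close>.
\<close>
lemma laguerre_polya_turan:
  assumes "laguerre_polya \<psi>"
    and sums: "\<And>z. (\<lambda>n. complex_of_real (\<gamma> n) * z ^ n / fact n) sums \<psi> z"
  shows "\<gamma> 0 * \<gamma> 2 \<le> (\<gamma> 1)\<^sup>2"
proof -
  let ?C = "map_poly complex_of_real"
  obtain p d where p: "\<And>n. only_real_zeros (p n)" and d: "0 < d"
    and lim: "uniform_limit (cball 0 d) (\<lambda>n. poly (?C (p n))) \<psi> sequentially"
    using assms(1) unfolding laguerre_polya_def by blast
  have coeff_lim: "(\<lambda>n. coeff (p n) k) \<longlonglongrightarrow> \<gamma> k / fact k" for k
  proof -
    have "(\<lambda>n. (deriv ^^ k) (poly (?C (p n))) 0) \<longlonglongrightarrow> (deriv ^^ k) \<psi> 0"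
    proof (rule higher_deriv_complex_uniform_limit)
      show "uniform_limit (ball 0 d) (\<lambda>n. poly (?C (p n))) \<psi> sequentially"
        by (rule uniform_limit_on_subset[OF lim]) auto
    qed (use d in \<open>auto intro!: always_eventually holomorphic_intros\<close>)
    then have "(\<lambda>n. (deriv ^^ k) (poly (?C (p n))) 0 / fact k) \<longlonglongrightarrow> (deriv ^^ k) \<psi> 0 / fact k"
      by (intro tendsto_divide) auto
    moreover have "(deriv ^^ k) (poly (?C (p n))) 0 / fact k = of_real (coeff (p n) k)" for n
    proof -
      have "(\<lambda>i. coeff (?C (p n)) i * z ^ i) sums poly (?C (p n)) z" for z
        unfolding poly_altdef by (rule sums_finite) (auto simp: coeff_eq_0)
      from powser_coeff_eq_higher_deriv[OF this, of k] show ?thesis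
        by (simp add: coeff_map_poly)
    qed
    moreover have "(deriv ^^ k) \<psi> 0 / fact k = of_real (\<gamma> k / fact k)"
      using powser_coeff_eq_higher_deriv[of "\<lambda>n. of_real (\<gamma> n) / fact n" \<psi> k] sums by simp
    ultimately show ?thesis
      by (simp only: tendsto_of_real_iff)
  qed
  have "2 * (\<gamma> 0 / fact 0) * (\<gamma> 2 / fact 2) \<le> (\<gamma> 1 / fact 1)\<^sup>2"
  proof (rule LIMSEQ_le)
    show "(\<lambda>n. 2 * coeff (p n) 0 * coeff (p n) 2) \<longlonglongrightarrow> 2 * (\<gamma> 0 / fact 0) * (\<gamma> 2 / fact 2)"
      by (intro tendsto_intros coeff_lim)
    show "(\<lambda>n. (coeff (p n) 1)\<^sup>2) \<longlonglongrightarrow> (\<gamma> 1 / fact 1)\<^sup>2"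
      by (intro tendsto_intros coeff_lim)
  qed (use only_real_zeros_coeff[OF p] in blast)
  then show ?thesis by simp
qed

section \<open>The characterization\<close>

theorem theorem7p3:
  fixes \<psi> :: "complex \<Rightarrow> complex" and \<gamma> :: "nat \<Rightarrow> real"
  assumes "laguerre_polya \<psi>"
    and "\<And>z. (\<lambda>n. complex_of_real (\<gamma> n) * z ^ n / fact n) sums \<psi> z"
    and "\<exists>z. \<psi> z \<noteq> 0"
  shows "completely_monotone \<gamma> \<longleftrightarrow>
    (\<exists>q\<in>{0..1::real}. \<gamma> 0 > 0 \<and>
       (\<forall>z. \<psi> z = complex_of_real (\<gamma> 0) * exp (complex_of_real q * z)))"
proof -
  have exp_sums: "(\<lambda>n. complex_of_real (a * q ^ n) * z ^ n / fact n) sums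
      (complex_of_real a * exp (complex_of_real q * z))" for a q z
    using sums_mult[OF exp_converges[of "complex_of_real q * z"], of "complex_of_real a"]
    by (simp add: scaleR_conv_of_real power_mult_distrib divide_simps mult_ac)
  show ?thesis
  proof
    assume cm: "completely_monotone \<gamma>"
    have dec: "\<gamma> (Suc n) \<le> \<gamma> n" for n
      by (rule completely_monotone_decreasing[OF cm])
    have nonneg: "0 \<le> \<gamma> n" for n
      by (rule completely_monotone_nonneg[OF cm])
    have pos: "0 < \<gamma> 0"
    proof (rule ccontr)
      assume "\<not> 0 < \<gamma> 0"
      moreover have "\<gamma> n \<le> \<gamma> 0" for n
        using dec by (rule lift_Suc_antimono_le) simp
      ultimately have "\<gamma> n = 0" for n
        using nonneg[of n] by (meson antisym not_less order_trans)
      then have "\<psi> z = 0" for z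
        using assms(2)[of z] sums_unique2[OF _ sums_zero] by simp
      then show False using assms(3) by simp
    qed
    define q where "q = \<gamma> 1 / \<gamma> 0"
    have geometric: "\<gamma> n = \<gamma> 0 * q ^ n" for n
      unfolding q_def
      by (rule completely_monotone_geometric[OF cm pos laguerre_polya_turan[OF assms(1,2)]])
    have "(\<lambda>n. complex_of_real (\<gamma> n) * z ^ n / fact n) sums
        (complex_of_real (\<gamma> 0) * exp (complex_of_real q * z))" for z
      using exp_sums[of "\<gamma> 0" q z] by (simp only: geometric[symmetric])
    then have "\<psi> z = complex_of_real (\<gamma> 0) * exp (complex_of_real q * z)" for z
      using assms(2) sums_unique2 by blast
    moreover have "q \<in> {0..1}"
      using pos nonneg[of 1] dec[of 0] by (simp add: q_def)
    ultimately show "\<exists>q\<in>{0..1::real}. \<gamma> 0 > 0 \<and>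
       (\<forall>z. \<psi> z = complex_of_real (\<gamma> 0) * exp (complex_of_real q * z))"
      using pos by blast
  next
    assume "\<exists>q\<in>{0..1::real}. \<gamma> 0 > 0 \<and>
       (\<forall>z. \<psi> z = complex_of_real (\<gamma> 0) * exp (complex_of_real q * z))"
    then obtain q where q: "0 \<le> q" "q \<le> 1" and pos: "0 < \<gamma> 0"
      and \<psi>: "\<And>z. \<psi> z = complex_of_real (\<gamma> 0) * exp (complex_of_real q * z)"
      by auto
    \<comment> \<open>Taylor coefficients are unique.\<close>
    have "complex_of_real (\<gamma> n) / fact n = complex_of_real (\<gamma> 0 * q ^ n) / fact n" for n
    proof -
      have "complex_of_real (\<gamma> n) / fact n = (deriv ^^ n) \<psi> 0 / fact n"
        using assms(2) by (intro powser_coeff_eq_higher_deriv) simp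
      also have "\<dots> = complex_of_real (\<gamma> 0 * q ^ n) / fact n"
        using exp_sums[of "\<gamma> 0" q]
        by (intro powser_coeff_eq_higher_deriv[symmetric]) (simp add: \<psi>)
      finally show ?thesis .
    qed
    then have "\<gamma> n = \<gamma> 0 * q ^ n" for n
      by (metis divide_cancel_right fact_nonzero of_real_eq_iff)
    then have "\<gamma> = (\<lambda>n. \<gamma> 0 * q ^ n)" by blast
    then have "(diff_op ^^ k) \<gamma> n = \<gamma> 0 * q ^ n * (1 - q) ^ k" for n k
      by (metis diff_op_funpow_geometric)
    then show "completely_monotone \<gamma>"
      using q pos by (simp add: completely_monotone_def)
  qed
qed

end
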